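(* The group $SO(3)$ is generated by reflections in lines through the origin of $\mathbb{R}^3$, and any relation in $SO(3)$ among reflections in lines follows from pencil, involution and polar frame relations. That is, if $l_1,\dots,l_n$ are lines through the origin with $R_{l_1}\circ R_{l_2}\circ\dots\circ R_{l_n}=\mathrm{id}$, then this relation is a consequence of pencil, involution and polar frame relations.
   Context: All lines are lines in $\mathbb{R}^3$ passing through the origin. For such a line $l$, the reflection in $l$, denoted $R_l$, is the rotation of $\mathbb{R}^3$ by $180^\circ$ about $l$; it belongs to $SO(3)$. A pencil relation is an equality $R_b\circ R_a=R_d\circ R_c$ that holds in $SO(3)$, where $a,b,c,d$ are coplanar lines with $\measuredangle(a,b)=\measuredangle(c,d)$ and $\measuredangle(a,c)=\measuredangle(b,d)$. An involution relation is an equality $R_l^2=\mathrm{id}$. A polar frame relation is an equality $R_c\circ R_b\circ R_a=\mathrm{id}$, where $a,b,c$ are pairwise orthogonal lines. A relation $R_{l_1}\circ\dots\circ R_{l_n}=\mathrm{id}$ follows from (is a consequence of) these relations if, in the free group on the set of symbols $\{r_l\}$ indexed by all lines $l$ through the origin, the word $r_{l_1}r_{l_2}\cdots r_{l_n}$ lies in the normal closure of the set of all elements $r_l^2$, $r_br_a(r_dr_c)^{-1}$ and $r_cr_br_a$ corresponding to involution, pencil and polar frame relations respectively. *)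

theory Defs
  imports "HOL-Analysis.Analysis" "HOL-Algebra.Generated_Groups"
begin

section \<open>Free groups and normal closures\<close>

text \<open>A letter \<open>(x, True)\<close> stands for the generator \<open>x\<close>, and \<open>(x, False)\<close> for its inverse.
  The elements of the free group on \<open>S\<close> are the reduced words in these letters.\<close>

definition inv_letter :: "'a \<times> bool \<Rightarrow> 'a \<times> bool"
  where "inv_letter p = (fst p, \<not> snd p)"

fun reduced_word :: "('a \<times> bool) list \<Rightarrow> bool"
  where
    "reduced_word (p # q # w) \<longleftrightarrow> q \<noteq> inv_letter p \<and> reduced_word (q # w)"
  | "reduced_word w \<longleftrightarrow> True"

fun push_letter :: "'a \<times> bool \<Rightarrow> ('a \<times> bool) list \<Rightarrow> ('a \<times> bool) list"
  where
    "push_letter p [] = [p]"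
  | "push_letter p (q # w) = (if q = inv_letter p then w else p # q # w)"

definition reduce :: "('a \<times> bool) list \<Rightarrow> ('a \<times> bool) list"
  where "reduce w = foldr push_letter w []"

definition free_group :: "'a set \<Rightarrow> ('a \<times> bool) list monoid"
  where "free_group S =
    \<lparr>carrier = {w. fst ` set w \<subseteq> S \<and> reduced_word w},
     monoid.mult = (\<lambda>u v. reduce (u @ v)),
     one = []\<rparr>"

definition free_gen :: "'a \<Rightarrow> ('a \<times> bool) list"
  where "free_gen x = [(x, True)]"

definition normal_closure :: "('a, 'b) monoid_scheme \<Rightarrow> 'a set \<Rightarrow> 'a set"
  where "normal_closure G T = \<Inter> {N. N \<lhd> G \<and> T \<subseteq> N}"

definition mult_list :: "('a, 'b) monoid_scheme \<Rightarrow> 'a list \<Rightarrow> 'a"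
  where "mult_list G xs = foldr (monoid.mult G) xs (one G)"


section \<open>Lines and reflections\<close>

definition lines :: "(real^3) set set"
  where "lines = {l. subspace l \<and> dim l = 1}"

definition SO3 :: "(real^3 \<Rightarrow> real^3) monoid"
  where "SO3 =
    \<lparr>carrier = {f. linear f \<and> rotation_matrix (matrix f)}, monoid.mult = (\<circ>), one = id\<rparr>"

text \<open>The rotation by \<open>180\<close> degrees about \<open>l\<close> fixes \<open>l\<close> pointwise and acts as \<open>-1\<close> on the
  orthogonal complement of \<open>l\<close>.\<close>

definition line_reflection :: "(real^3) set \<Rightarrow> real^3 \<Rightarrow> real^3"
  where "line_reflection l =
    (THE f. linear f \<and> (\<forall>x\<in>l. f x = x) \<and> (\<forall>x\<in>l\<^sup>\<bottom>. f x = - x))"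

definition orthogonal_lines :: "(real^3) set \<Rightarrow> (real^3) set \<Rightarrow> bool"
  where "orthogonal_lines a b \<longleftrightarrow> (\<forall>x\<in>a. \<forall>y\<in>b. orthogonal x y)"

text \<open>The angle between two lines, in the range from \<open>0\<close> to \<open>pi / 2\<close>.\<close>

definition line_angle :: "(real^3) set \<Rightarrow> (real^3) set \<Rightarrow> real"
  where "line_angle a b =
    (THE t. \<exists>u\<in>a. \<exists>v\<in>b. norm u = 1 \<and> norm v = 1 \<and> t = arccos \<bar>u \<bullet> v\<bar>)"


section \<open>The three kinds of relations\<close>

text \<open>Equality of the unoriented angles alone does not imply
  \<open>R\<^sub>b \<circ> R\<^sub>a = R\<^sub>d \<circ> R\<^sub>c\<close>; it is a separate requirement. Lemma \<open>pencil_relation_iff\<close>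
  below shows that the conjunction is equality of the oriented angles modulo \<open>pi\<close>.\<close>

definition pencil_relation ::
  "(real^3) set \<Rightarrow> (real^3) set \<Rightarrow> (real^3) set \<Rightarrow> (real^3) set \<Rightarrow> bool"
  where "pencil_relation a b c d \<longleftrightarrow>
    a \<in> lines \<and> b \<in> lines \<and> c \<in> lines \<and> d \<in> lines \<and>
    coplanar (a \<union> b \<union> c \<union> d) \<and>
    line_angle a b = line_angle c d \<and> line_angle a c = line_angle b d \<and>
    line_reflection b \<circ> line_reflection a = line_reflection d \<circ> line_reflection c"

definition polar_frame :: "(real^3) set \<Rightarrow> (real^3) set \<Rightarrow> (real^3) set \<Rightarrow> bool"
  where "polar_frame a b c \<longleftrightarrow>
    a \<in> lines \<and> b \<in> lines \<and> c \<in> lines \<and>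
    orthogonal_lines a b \<and> orthogonal_lines b c \<and> orthogonal_lines a c"

abbreviation line_group :: "((real^3) set \<times> bool) list monoid"
  where "line_group \<equiv> free_group lines"

definition involution_relators :: "((real^3) set \<times> bool) list set"
  where "involution_relators =
    {free_gen l \<otimes>\<^bsub>line_group\<^esub> free_gen l | l. l \<in> lines}"

definition pencil_relators :: "((real^3) set \<times> bool) list set"
  where "pencil_relators =
    {(free_gen b \<otimes>\<^bsub>line_group\<^esub> free_gen a) \<otimes>\<^bsub>line_group\<^esub>
       inv\<^bsub>line_group\<^esub> (free_gen d \<otimes>\<^bsub>line_group\<^esub> free_gen c)
     | a b c d. pencil_relation a b c d}"

definition polar_frame_relators :: "((real^3) set \<times> bool) list set"
  where "polar_frame_relators =
    {free_gen c \<otimes>\<^bsub>line_group\<^esub> free_gen b \<otimes>\<^bsub>line_group\<^esub> free_gen a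
     | a b c. polar_frame a b c}"


section \<open>Basic facts\<close>

subsection \<open>The free group\<close>

lemma inv_letter_inv_letter [simp]: "inv_letter (inv_letter p) = p"
  by (simp add: inv_letter_def)

lemma fst_inv_letter [simp]: "fst (inv_letter p) = fst p"
  by (simp add: inv_letter_def)

lemma reduced_tl: "reduced_word (p # w) \<Longrightarrow> reduced_word w"
  by (cases w) auto

lemma reduced_push: "reduced_word w \<Longrightarrow> reduced_word (push_letter p w)"
  by (cases w) (auto dest: reduced_tl)

lemma push_push:
  assumes "reduced_word w"
  shows "push_letter p (push_letter (inv_letter p) w) = w"
proof (cases w)
  case (Cons q v)
  show ?thesis
  proof (cases "q = p")
    case True
    then show ?thesis using Cons assms by (cases v) auto
  qed (use Cons in auto)
qed auto

lemma reduced_foldr: "reduced_word w \<Longrightarrow> reduced_word (foldr push_letter u w)"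
  by (induction u) (auto intro: reduced_push)

lemma reduced_reduce: "reduced_word (reduce w)"
  by (simp add: reduce_def reduced_foldr)

lemma reduce_reduced: "reduced_word w \<Longrightarrow> reduce w = w"
proof (induction w)
  case (Cons p w)
  then have "reduce w = w" by (auto dest: reduced_tl)
  then show ?case using Cons.prems by (cases w) (auto simp: reduce_def)
qed (simp add: reduce_def)

lemma foldr_push_letter:
  assumes "reduced_word w" "reduced_word v"
  shows "foldr push_letter (push_letter p v) w = push_letter p (foldr push_letter v w)"
proof (cases v)
  case (Cons q v')
  have "reduced_word (foldr push_letter v' w)" by (simp add: assms reduced_foldr)
  from push_push[OF this, of p] show ?thesis using Cons by simp
qed auto

lemma foldr_reduce:
  assumes "reduced_word w"
  shows "foldr push_letter (reduce u) w = foldr push_letter u w"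
proof (induction u)
  case (Cons p u)
  have "reduce (p # u) = push_letter p (reduce u)" by (simp add: reduce_def)
  then show ?case using foldr_push_letter[OF assms reduced_reduce] Cons by auto
qed (simp add: reduce_def)

lemma reduce_append: "reduce (u @ v) = foldr push_letter u (reduce v)"
  by (simp add: reduce_def)

lemma set_push: "set (push_letter p w) \<subseteq> insert p (set w)"
  by (cases w) auto

lemma set_reduce: "set (reduce w) \<subseteq> set w"
  unfolding reduce_def by (induction w) (use set_push in fastforce)+

lemma foldr_push_inv:
  assumes "reduced_word v"
  shows "foldr push_letter (rev (map inv_letter w)) (foldr push_letter w v) = v"
proof (induction w)
  case (Cons p w)
  have "reduced_word (foldr push_letter w v)" by (simp add: assms reduced_foldr)
  from push_push[OF this, of "inv_letter p"] Cons show ?case by simp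
qed (simp add: assms)

lemma group_free_group: "group (free_group S)"
proof (rule groupI)
  fix u v w
  assume "u \<in> carrier (free_group S)" "v \<in> carrier (free_group S)" "w \<in> carrier (free_group S)"
  then show "u \<otimes>\<^bsub>free_group S\<^esub> v \<otimes>\<^bsub>free_group S\<^esub> w
      = u \<otimes>\<^bsub>free_group S\<^esub> (v \<otimes>\<^bsub>free_group S\<^esub> w)"
    by (simp add: free_group_def reduce_append reduce_reduced reduced_foldr foldr_reduce
        reduced_reduce flip: foldr_append)
      (metis foldr_append foldr_reduce reduce_append reduce_reduced)
next
  fix u v
  assume "u \<in> carrier (free_group S)" "v \<in> carrier (free_group S)"
  then show "u \<otimes>\<^bsub>free_group S\<^esub> v \<in> carrier (free_group S)"
    using set_reduce[of "u @ v"] by (fastforce simp: free_group_def reduced_reduce)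
next
  fix w
  assume w: "w \<in> carrier (free_group S)"
  let ?v = "reduce (rev (map inv_letter w))"
  have "reduce (?v @ w) = foldr push_letter (rev (map inv_letter w)) (reduce w)"
    by (simp add: reduce_append foldr_reduce reduced_reduce)
  also have "\<dots> = []" unfolding reduce_def[of w] by (simp add: foldr_push_inv)
  finally have "?v \<otimes>\<^bsub>free_group S\<^esub> w = \<one>\<^bsub>free_group S\<^esub>"
    by (simp add: free_group_def)
  moreover have "?v \<in> carrier (free_group S)"
  proof -
    have "fst ` set ?v \<subseteq> fst ` set (rev (map inv_letter w))" using set_reduce by blast
    also have "\<dots> = fst ` set w" by (simp add: image_image)
    also have "\<dots> \<subseteq> S" using w by (simp add: free_group_def)
    finally show ?thesis by (simp add: free_group_def reduced_reduce)
  qed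
  ultimately show "\<exists>y\<in>carrier (free_group S). y \<otimes>\<^bsub>free_group S\<^esub> w = \<one>\<^bsub>free_group S\<^esub>"
    by blast
qed (auto simp: free_group_def reduce_reduced)

lemma free_gen_closed: "x \<in> S \<Longrightarrow> free_gen x \<in> carrier (free_group S)"
  by (simp add: free_gen_def free_group_def)

lemma inv_free_gen: "x \<in> S \<Longrightarrow> inv\<^bsub>free_group S\<^esub> (free_gen x) = [(x, False)]"
  by (rule group.inv_equality[OF group_free_group])
    (auto simp: free_gen_def free_group_def reduce_def inv_letter_def)

lemma (in group) normal_closure_normal:
  assumes "T \<subseteq> carrier G"
  shows "normal_closure G T \<lhd> G"
proof -
  let ?F = "{N. N \<lhd> G \<and> T \<subseteq> N}"
  have ne: "carrier G \<in> ?F" using assms by (auto simp: normal_inv_iff subgroup_self)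
  have "subgroup (\<Inter>?F) G"
    by (rule subgroups_Inter) (use ne in \<open>auto simp: normal_inv_iff\<close>)
  then show ?thesis
    unfolding normal_closure_def by (auto simp: normal_inv_iff)
qed

theorem free_group_universal:
  assumes "group H" and f: "\<And>x. x \<in> S \<Longrightarrow> f x \<in> carrier H"
  shows "\<exists>h \<in> hom (free_group S) H. \<forall>x\<in>S. h (free_gen x) = f x"
proof -
  interpret H: group H by fact
  define g where "g p = (if snd p then f (fst p) else inv\<^bsub>H\<^esub> f (fst p))" for p
  define h where "h w = mult_list H (map g w)" for w
  have h_Nil: "h [] = \<one>\<^bsub>H\<^esub>" and h_Cons: "h (p # w) = g p \<otimes>\<^bsub>H\<^esub> h w" for p w
    by (auto simp: h_def mult_list_def)
  have g: "g p \<in> carrier H" if "fst p \<in> S" for p using f that by (simp add: g_def)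
  have g_inv: "g p \<otimes>\<^bsub>H\<^esub> g (inv_letter p) = \<one>\<^bsub>H\<^esub>" if "fst p \<in> S" for p
    using f that by (simp add: g_def inv_letter_def)
  have h: "h w \<in> carrier H" if "fst ` set w \<subseteq> S" for w
    using that by (induction w) (auto simp: h_Nil h_Cons g)
  have h_push: "h (push_letter p w) = g p \<otimes>\<^bsub>H\<^esub> h w" if "fst p \<in> S" "fst ` set w \<subseteq> S" for p w
  proof (cases w)
    case (Cons q v)
    then show ?thesis
      using that g[of p] g[of q] h[of v] g_inv[of p] by (auto simp: h_Cons simp flip: H.m_assoc)
  qed (simp add: h_Nil h_Cons)
  have set_f: "fst ` set (foldr push_letter u w) \<subseteq> S" if "fst ` set u \<subseteq> S" "fst ` set w \<subseteq> S" for u w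
    using that
  proof (induction u)
    case (Cons p u)
    have "fst ` set (push_letter p (foldr push_letter u w))
        \<subseteq> fst ` insert p (set (foldr push_letter u w))"
      using set_push by (rule image_mono)
    also have "\<dots> \<subseteq> S" using Cons by simp
    finally show ?case by simp
  qed auto
  have h_f: "h (foldr push_letter u w) = h u \<otimes>\<^bsub>H\<^esub> h w"
    if "fst ` set u \<subseteq> S" "fst ` set w \<subseteq> S" for u w
    using that
  proof (induction u)
    case (Cons p u)
    then show ?case
      using h_push[of p "foldr push_letter u w"] set_f[of u w] g[of p] h[of u] h[of w]
      by (simp add: h_Cons H.m_assoc)
  qed (simp add: h_Nil h)
  have "h \<in> hom (free_group S) H"
    by (rule homI) (auto simp: free_group_def h h_f reduce_append reduce_reduced)
  moreover have "h (free_gen x) = f x" if "x \<in> S" for x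
    using f that by (simp add: free_gen_def h_Cons h_Nil g_def)
  ultimately show ?thesis by blast
qed


subsection \<open>Reflections in lines\<close>

lemma lines_iff: "l \<in> lines \<longleftrightarrow> (\<exists>u. norm u = 1 \<and> l = span {u})"
proof
  assume "l \<in> lines"
  then have l: "subspace l" "dim l = 1" by (auto simp: lines_def)
  then obtain B where B: "B \<subseteq> l" "independent B" "l \<subseteq> span B" "card B = 1"
    by (metis basis_exists)
  then obtain v where v: "B = {v}" by (meson card_1_singletonE)
  then have "v \<noteq> 0" using B dependent_single by blast
  have "l = span {v}" using B v l span_minimal by (metis subset_antisym)
  moreover have "span {v} = span {v /\<^sub>R norm v}"
  proof
    have "v = norm v *\<^sub>R (v /\<^sub>R norm v)" using \<open>v \<noteq> 0\<close> by simp
    then have "v \<in> span {v /\<^sub>R norm v}" by (metis insertI1 span_base span_scale)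
    then show "span {v} \<subseteq> span {v /\<^sub>R norm v}" by (intro span_minimal) auto
    show "span {v /\<^sub>R norm v} \<subseteq> span {v}"
      by (intro span_minimal) (auto simp: span_base span_scale)
  qed
  moreover have "norm (v /\<^sub>R norm v) = 1" using \<open>v \<noteq> 0\<close> by simp
  ultimately show "\<exists>u. norm u = 1 \<and> l = span {u}" by metis
next
  assume "\<exists>u. norm u = 1 \<and> l = span {u}"
  then obtain u where "norm u = 1" "l = span {u}" by blast
  moreover from this have "u \<noteq> 0" by auto
  ultimately show "l \<in> lines" by (auto simp: lines_def)
qed

lemma line_reflection_span:
  assumes "norm u = 1"
  shows "line_reflection (span {u}) = (\<lambda>x. (2 * (x \<bullet> u)) *\<^sub>R u - x)" (is "_ = ?f")
proof -
  have uu: "u \<bullet> u = 1" using assms by (simp add: norm_eq_1)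
  have lin: "linear ?f"
    by (rule linearI) (simp_all add: algebra_simps)
  show ?thesis
    unfolding line_reflection_def
  proof (rule the_equality)
    show "linear ?f \<and> (\<forall>x\<in>span {u}. ?f x = x) \<and> (\<forall>x\<in>(span {u})\<^sup>\<bottom>. ?f x = - x)"
    proof (intro conjI lin ballI)
      fix x assume "x \<in> span {u}"
      then obtain k where "x = k *\<^sub>R u" by (auto simp: span_singleton)
      then show "?f x = x" using uu by (simp flip: scaleR_left_diff_distrib)
    next
      fix x assume "x \<in> (span {u})\<^sup>\<bottom>"
      moreover have "u \<in> span {u}" by (simp add: span_base)
      ultimately have "u \<bullet> x = 0" unfolding orthogonal_comp_def orthogonal_def by blast
      then have "x \<bullet> u = 0" by (simp add: inner_commute)
      then show "?f x = - x" by simp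
    qed
  next
    fix f :: "real^3 \<Rightarrow> real^3"
    assume f: "linear f \<and> (\<forall>x\<in>span {u}. f x = x) \<and> (\<forall>x\<in>(span {u})\<^sup>\<bottom>. f x = - x)"
    show "f = ?f"
    proof
      fix x
      let ?p = "(x \<bullet> u) *\<^sub>R u"
      have p: "?p \<in> span {u}" by (simp add: span_base span_scale)
      have q: "x - ?p \<in> (span {u})\<^sup>\<bottom>"
        using uu by (auto simp: orthogonal_comp_def orthogonal_def span_singleton
            inner_diff_right inner_commute[of u x])
      have "f (?p + (x - ?p)) = f ?p + f (x - ?p)" using f linear_add by blast
      then have "f x = f ?p + f (x - ?p)" by simp
      also have "\<dots> = ?p + - (x - ?p)" using f p q by simp
      also have "\<dots> = ?f x" by (simp only: mult_2 scaleR_left_distrib) simp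
      finally show "f x = ?f x" .
    qed
  qed
qed

lemma line_angle_span:
  assumes "norm u = 1" "norm v = 1"
  shows "line_angle (span {u}) (span {v}) = arccos \<bar>u \<bullet> v\<bar>"
  unfolding line_angle_def
proof (rule the_equality)
  show "\<exists>u'\<in>span {u}. \<exists>v'\<in>span {v}. norm u' = 1 \<and> norm v' = 1 \<and> arccos \<bar>u \<bullet> v\<bar> = arccos \<bar>u' \<bullet> v'\<bar>"
    using assms by (intro bexI[of _ u] bexI[of _ v]) (auto simp: span_base)
qed (use assms in \<open>auto simp: span_singleton abs_mult\<close>)

lemma pencil_relation_iff:
  fixes e f :: "real^3"
  defines "L \<equiv> \<lambda>t. span {cos t *\<^sub>R e + sin t *\<^sub>R f}"
  assumes "norm e = 1" "norm f = 1" "e \<bullet> f = 0"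
  shows "pencil_relation (L \<alpha>) (L \<beta>) (L \<gamma>) (L \<delta>)
    \<longleftrightarrow> (\<exists>k::int. \<beta> - \<alpha> = \<delta> - \<gamma> + of_int k * pi)"
proof -
  define v where "v t = cos t *\<^sub>R e + sin t *\<^sub>R f" for t
  have ip: "e \<bullet> e = 1" "f \<bullet> f = 1" "e \<bullet> f = 0" "f \<bullet> e = 0"
    using assms by (auto simp: norm_eq_1 inner_commute)
  have vv: "v s \<bullet> v t = cos (t - s)" for s t
    using ip by (simp add: v_def inner_left_distrib inner_right_distrib cos_diff)
  have n: "norm (v t) = 1" for t using vv[of t t] by (simp add: norm_eq_1)
  have L: "L t = span {v t}" for t by (simp add: L_def v_def)
  have lines: "L t \<in> lines" for t using n L lines_iff by blast
  have cop: "coplanar (L \<alpha> \<union> L \<beta> \<union> L \<gamma> \<union> L \<delta>)"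
  proof -
    have "L t \<subseteq> span {e, f}" for t
      unfolding L by (rule span_minimal) (auto simp: v_def span_add span_base span_scale)
    moreover have "span {e, f} = affine hull {0, e, f}"
      by (simp add: affine_hull_span_0 hull_inc span_insert_0)
    ultimately show ?thesis unfolding coplanar_def by blast
  qed
  have ang: "line_angle (L s) (L t) = arccos \<bar>cos (t - s)\<bar>" for s t
    using line_angle_span[OF n n] by (simp add: L vv)
  have R: "line_reflection (L t) x = (2 * (x \<bullet> v t)) *\<^sub>R v t - x" for t x
    using line_reflection_span[OF n] by (simp add: L)
  have RR: "line_reflection (L t) (line_reflection (L s) x) =
      x + ((cos (2 * (t - s)) - 1) * (x \<bullet> e) - sin (2 * (t - s)) * (x \<bullet> f)) *\<^sub>R e
        + (sin (2 * (t - s)) * (x \<bullet> e) + (cos (2 * (t - s)) - 1) * (x \<bullet> f)) *\<^sub>R f" for s t x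
  proof -
    have "line_reflection (L t) (line_reflection (L s) x) =
      x + (4 * (x \<bullet> v s) * cos (t - s) - 2 * (x \<bullet> v t)) *\<^sub>R v t - (2 * (x \<bullet> v s)) *\<^sub>R v s"
      by (simp add: R inner_diff_left vv algebra_simps)
    also have "\<dots> = x
      + ((4 * (x \<bullet> v s) * cos (t - s) - 2 * (x \<bullet> v t)) * cos t - 2 * (x \<bullet> v s) * cos s) *\<^sub>R e
      + ((4 * (x \<bullet> v s) * cos (t - s) - 2 * (x \<bullet> v t)) * sin t - 2 * (x \<bullet> v s) * sin s) *\<^sub>R f"
      by (simp add: v_def algebra_simps)
    also have "(4 * (x \<bullet> v s) * cos (t - s) - 2 * (x \<bullet> v t)) * cos t - 2 * (x \<bullet> v s) * cos s
      = (cos (2 * (t - s)) - 1) * (x \<bullet> e) - sin (2 * (t - s)) * (x \<bullet> f)"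
    proof -
      have "sin t ^ 2 = 1 - cos t ^ 2" "sin s ^ 2 = 1 - cos s ^ 2" by (simp_all add: sin_squared_eq)
      then show ?thesis unfolding cos_double sin_double
        by (simp add: v_def inner_right_distrib cos_diff sin_diff) algebra
    qed
    also have "(4 * (x \<bullet> v s) * cos (t - s) - 2 * (x \<bullet> v t)) * sin t - 2 * (x \<bullet> v s) * sin s
      = sin (2 * (t - s)) * (x \<bullet> e) + (cos (2 * (t - s)) - 1) * (x \<bullet> f)"
    proof -
      have "sin t ^ 2 = 1 - cos t ^ 2" "sin s ^ 2 = 1 - cos s ^ 2" by (simp_all add: sin_squared_eq)
      then show ?thesis unfolding cos_double sin_double
        by (simp add: v_def inner_right_distrib cos_diff sin_diff) algebra
    qed
    finally show ?thesis .
  qed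
  show ?thesis
  proof
    assume "pencil_relation (L \<alpha>) (L \<beta>) (L \<gamma>) (L \<delta>)"
    then have "line_reflection (L \<beta>) (line_reflection (L \<alpha>) e)
        = line_reflection (L \<delta>) (line_reflection (L \<gamma>) e)"
      unfolding pencil_relation_def by (metis comp_apply)
    then have eq: "e + (cos (2 * (\<beta> - \<alpha>)) - 1) *\<^sub>R e + sin (2 * (\<beta> - \<alpha>)) *\<^sub>R f
        = e + (cos (2 * (\<delta> - \<gamma>)) - 1) *\<^sub>R e + sin (2 * (\<delta> - \<gamma>)) *\<^sub>R f"
      unfolding RR by (simp add: ip)
    have "cos (2 * (\<beta> - \<alpha>)) = cos (2 * (\<delta> - \<gamma>))"
      using arg_cong[OF eq, of "\<lambda>y. y \<bullet> e"] by (simp add: inner_left_distrib ip)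
    moreover have "sin (2 * (\<beta> - \<alpha>)) = sin (2 * (\<delta> - \<gamma>))"
      using arg_cong[OF eq, of "\<lambda>y. y \<bullet> f"] by (simp add: inner_left_distrib ip)
    ultimately obtain k :: int where "2 * (\<beta> - \<alpha>) = 2 * (\<delta> - \<gamma>) + 2 * pi * of_int k"
      using sin_cos_eq_iff by (metis mult.assoc mult.commute)
    then have "\<beta> - \<alpha> = \<delta> - \<gamma> + of_int k * pi" by argo
    then show "\<exists>k::int. \<beta> - \<alpha> = \<delta> - \<gamma> + of_int k * pi" ..
  next
    assume "\<exists>k::int. \<beta> - \<alpha> = \<delta> - \<gamma> + of_int k * pi"
    then obtain k :: int where k: "\<beta> - \<alpha> = \<delta> - \<gamma> + of_int k * pi" ..
    have per: "\<bar>cos (x + of_int k * pi)\<bar> = \<bar>cos x\<bar>" for x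
      by (simp add: cos_add abs_mult mult.commute[of _ pi] sin_npi_int cos_npi_int)
    have k': "\<delta> - \<beta> = (\<gamma> - \<alpha>) - of_int k * pi" using k by simp
    have "\<bar>cos (\<beta> - \<alpha>)\<bar> = \<bar>cos (\<delta> - \<gamma>)\<bar>" unfolding k by (rule per)
    moreover have "\<bar>cos (\<gamma> - \<alpha>)\<bar> = \<bar>cos (\<delta> - \<beta>)\<bar>" using per[of "\<delta> - \<beta>"] k' by simp
    moreover have "2 * (\<beta> - \<alpha>) = 2 * (\<delta> - \<gamma>) + 2 * pi * of_int k" using k by simp
    then have "sin (2 * (\<beta> - \<alpha>)) = sin (2 * (\<delta> - \<gamma>)) \<and> cos (2 * (\<beta> - \<alpha>)) = cos (2 * (\<delta> - \<gamma>))"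
      using sin_cos_eq_iff by blast
    ultimately show "pencil_relation (L \<alpha>) (L \<beta>) (L \<gamma>) (L \<delta>)"
      unfolding pencil_relation_def using lines cop by (auto simp: ang RR fun_eq_iff)
  qed
qed

lemma line_reflection_in_SO3:
  assumes "l \<in> lines"
  shows "line_reflection l \<in> carrier SO3"
proof -
  obtain u where u: "norm u = 1" "l = span {u}" using assms lines_iff by blast
  have R: "line_reflection l = (\<lambda>x. (2 * (x \<bullet> u)) *\<^sub>R u - x)"
    using line_reflection_span u by simp
  have uu: "u \<bullet> u = 1" using u by (simp add: norm_eq_1)
  have lin: "linear (line_reflection l)"
    unfolding R by (rule linearI) (simp_all add: algebra_simps)
  have orth: "orthogonal_transformation (line_reflection l)"
    unfolding orthogonal_transformation_def
  proof (intro conjI lin allI)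
    fix x y
    show "line_reflection l x \<bullet> line_reflection l y = x \<bullet> y"
      unfolding R using uu by (simp add: inner_diff_left inner_diff_right inner_commute)
  qed
  have "u$1 * u$1 + u$2 * u$2 + u$3 * u$3 = 1"
    using uu by (simp add: inner_vec_def sum_3)
  then have "det (matrix (line_reflection l)) = 1"
    unfolding R by (simp add: det_3 matrix_def axis_def inner_vec_def sum_3) algebra
  then show ?thesis
    using orth lin by (simp add: SO3_def rotation_matrix_def orthogonal_transformation_matrix)
qed

lemma group_SO3: "group SO3"
proof (rule groupI)
  fix f assume "f \<in> carrier SO3"
  then have f: "linear f" "orthogonal_transformation f" "det (matrix f) = 1"
    by (auto simp: SO3_def rotation_matrix_def orthogonal_transformation_matrix)
  obtain g where g0: "linear g" "\<And>x. g (f x) = x" "\<And>x. f (g x) = x"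
    using linear_injective_isomorphism[OF f(1) orthogonal_transformation_inj[OF f(2)]] by blast
  then have g: "linear g" "g \<circ> f = id" by (auto simp: fun_eq_iff)
  have "g x \<bullet> g y = x \<bullet> y" for x y
    using f(2) g0(3) unfolding orthogonal_transformation_def by metis
  then have "orthogonal_transformation g"
    using g(1) by (simp add: orthogonal_transformation_def)
  moreover have "det (matrix g) * det (matrix f) = 1"
    using g f by (metis det_I det_mul matrix_compose matrix_id_mat_1)
  ultimately have "g \<in> carrier SO3"
    using f g by (simp add: SO3_def rotation_matrix_def orthogonal_transformation_matrix)
  then show "\<exists>g\<in>carrier SO3. g \<otimes>\<^bsub>SO3\<^esub> f = \<one>\<^bsub>SO3\<^esub>"
    using g by (auto simp: SO3_def)
qed (auto simp: SO3_def rotation_matrix_def matrix_compose linear_compose det_mul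
    orthogonal_matrix_mul matrix_id_mat_1 orthogonal_matrix_id linear_id comp_assoc)

end

theory Submission
  imports Defs
begin

text \<open>Modulo the relators every word equals a product \<open>r\<^sub>a r\<^sub>b\<close> of two generators. To
  absorb a further letter \<open>r\<^sub>l\<close> on the left, choose a line \<open>m\<close> orthogonal to \<open>l\<close> in a plane
  containing \<open>a\<close> and \<open>b\<close>: a polar frame relation gives \<open>r\<^sub>l = r\<^sub>c r\<^sub>m\<close>, a pencil relation gives
  \<open>r\<^sub>a r\<^sub>b = r\<^sub>m r\<^sub>d\<close>, and the involution relation for \<open>m\<close> leaves \<open>r\<^sub>c r\<^sub>d\<close>. Finally
  \<open>R\<^sub>a \<circ> R\<^sub>b = id\<close> forces \<open>a = b\<close>. For generation, two vectors of an orthonormal frame are moved to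
  prescribed positions by reflections, and a rotation fixing both fixes their cross product.\<close>

unbundle cross3_syntax

section \<open>Unit vectors and orthonormal frames in space\<close>

lemma span_in_lines: "norm u = 1 \<Longrightarrow> span {u} \<in> lines"
  using lines_iff by blast

text \<open>The span of two vectors has dimension at most 2. Independence is not assumed, so
  parallel or equal vectors are covered, as happens when two lines coincide.\<close>

lemma exists_unit_orthogonal2:
  fixes x y :: "real^3"
  obtains z where "norm z = 1" "z \<bullet> x = 0" "z \<bullet> y = 0"
proof -
  have "dim {x, y} < DIM(real^3)"
    using dim_le_card'[of "{x, y}"] card_insert_le_m1[of 2 "{y}" x] by simp
  then obtain w where w: "w \<noteq> 0" "\<And>v. v \<in> span {x, y} \<Longrightarrow> orthogonal w v"
    using orthogonal_to_subspace_exists by blast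
  then have "w \<bullet> x = 0" "w \<bullet> y = 0" by (auto simp: span_base simp flip: orthogonal_def)
  then show thesis using w(1) by (intro that[of "w /\<^sub>R norm w"]) auto
qed

text \<open>An instance of Lagrange's identity for the cross product.\<close>

lemma norm_cross_orthonormal:
  assumes "norm n = 1" "norm e = 1" "n \<bullet> e = 0"
  shows "norm (n \<times> e) = 1"
  using norm_cross_dot[of n e] assms by (simp add: power2_eq_1_iff) (smt (verit) norm_ge_zero)

text \<open>Pairwise orthogonal nonzero vectors are independent, and three of them span the space by
  dimension.\<close>

lemma orthonormal3_expand:
  fixes u v w x :: "real^3"
  assumes "norm u = 1" "norm v = 1" "norm w = 1" "u \<bullet> v = 0" "v \<bullet> w = 0" "u \<bullet> w = 0"
  shows "(x \<bullet> u) *\<^sub>R u + (x \<bullet> v) *\<^sub>R v + (x \<bullet> w) *\<^sub>R w = x"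
proof -
  let ?B = "{u, v, w}"
  have ne: "u \<noteq> v" "v \<noteq> w" "u \<noteq> w" using assms by auto
  have orth: "pairwise orthogonal ?B"
    using assms by (auto simp: pairwise_def orthogonal_def inner_commute)
  have "0 \<notin> ?B" using assms by auto
  then have "independent ?B" by (rule pairwise_orthogonal_independent[OF orth])
  moreover have "card ?B = dim (UNIV :: (real^3) set)" using ne by simp
  ultimately have "x \<in> span ?B" using card_eq_dim[of ?B UNIV] by auto
  then have "(\<Sum>i\<in>?B. (x \<bullet> i) *\<^sub>R i) = x"
    using assms by (intro orthonormal_basis_expand[OF orth]) auto
  then show ?thesis using ne by (simp add: add.assoc)
qed

text \<open>Provides the angular coordinate in the plane orthogonal to \<open>n\<close> in which
  \<open>pencil_relation_iff\<close> is phrased, with \<open>e\<close> at angle 0.\<close>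

lemma unit_orthogonal_eq_cos_sin:
  assumes "norm n = 1" "norm e = 1" "n \<bullet> e = 0" "norm u = 1" "n \<bullet> u = 0"
  obtains t where "u = cos t *\<^sub>R e + sin t *\<^sub>R (n \<times> e)"
proof -
  let ?f = "n \<times> e"
  have f: "norm ?f = 1" by (rule norm_cross_orthonormal) fact+
  have u: "u = (u \<bullet> e) *\<^sub>R e + (u \<bullet> ?f) *\<^sub>R ?f"
    using orthonormal3_expand[of n e ?f u] assms f by (simp add: dot_cross_self inner_commute)
  have "u \<bullet> u = (u \<bullet> e)\<^sup>2 + (u \<bullet> ?f)\<^sup>2"
    by (subst (2) u) (simp add: inner_right_distrib power2_eq_square)
  then have "(u \<bullet> e)\<^sup>2 + (u \<bullet> ?f)\<^sup>2 = 1" using assms(4) by (simp add: norm_eq_1)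
  then obtain t where "u \<bullet> e = cos t" "u \<bullet> ?f = sin t" by (metis sincos_total_2pi)
  then show thesis using u that by metis
qed


section \<open>Reduction to words of length two\<close>

lemma polar_frame_span:
  assumes "norm u = 1" "norm v = 1" "norm w = 1" "u \<bullet> v = 0" "v \<bullet> w = 0" "u \<bullet> w = 0"
  shows "polar_frame (span {u}) (span {v}) (span {w})"
  using assms span_in_lines unfolding polar_frame_def orthogonal_lines_def orthogonal_def
  by (auto simp: span_breakdown_eq)

lemma exists_pencil_polar_frame:
  assumes "l \<in> lines" "a \<in> lines" "b \<in> lines"
  obtains c d m where "polar_frame l m c" "pencil_relation b a d m"
proof -
  obtain w u v where w: "norm w = 1" "l = span {w}" and u: "norm u = 1" "a = span {u}"
    and v: "norm v = 1" "b = span {v}"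
    using assms unfolding lines_iff by blast
  \<comment> \<open>A normal of a plane containing \<open>a\<close> and \<open>b\<close>.\<close>
  obtain n where n: "norm n = 1" "n \<bullet> u = 0" "n \<bullet> v = 0" by (rule exists_unit_orthogonal2)
  \<comment> \<open>The direction of \<open>m\<close>: it lies in that plane and is orthogonal to
    \<open>l\<close>.\<close>
  obtain e where e: "norm e = 1" "e \<bullet> n = 0" "e \<bullet> w = 0" by (rule exists_unit_orthogonal2)
  then have ne: "n \<bullet> e = 0" and we: "w \<bullet> e = 0" by (simp_all add: inner_commute)
  obtain s where s: "u = cos s *\<^sub>R e + sin s *\<^sub>R (n \<times> e)"
    by (rule unit_orthogonal_eq_cos_sin[OF n(1) e(1) ne u(1) n(2)])
  obtain t where t: "v = cos t *\<^sub>R e + sin t *\<^sub>R (n \<times> e)"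
    by (rule unit_orthogonal_eq_cos_sin[OF n(1) e(1) ne v(1) n(3)])
  define L where "L r = span {cos r *\<^sub>R e + sin r *\<^sub>R (n \<times> e)}" for r
  \<comment> \<open>With \<open>b\<close> at angle \<open>t\<close>, \<open>a\<close> at
    \<open>s\<close> and \<open>m\<close> at 0, the line \<open>d\<close> must sit at
    \<open>t - s\<close>: the turn from \<open>d\<close> to \<open>m\<close> is then
    \<open>s - t\<close>, the turn from \<open>b\<close> to \<open>a\<close>.\<close>
  have "pencil_relation (L t) (L s) (L (t - s)) (L 0)"
    unfolding L_def
    by (subst pencil_relation_iff) 
      (auto simp: e norm_cross_orthonormal[OF n(1) e(1) ne] dot_cross_self intro: exI[of _ 0])
  then have "pencil_relation b a (L (t - s)) (span {e})"
    using u v s t by (simp add: L_def)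
  moreover have "polar_frame l (span {e}) (span {w \<times> e})"
    unfolding w(2)
    by (rule polar_frame_span)
      (simp_all add: w(1) e(1) we norm_cross_orthonormal dot_cross_self)
  ultimately show thesis using that by blast
qed

section \<open>Reflections as concrete maps\<close>

lemma line_reflection_involution:
  assumes "l \<in> lines"
  shows "line_reflection l \<circ> line_reflection l = id"
proof -
  obtain u where "norm u = 1" "l = span {u}" using assms lines_iff by blast
  then show ?thesis
    by (simp add: line_reflection_span fun_eq_iff norm_eq_1 inner_diff_left)
qed

text \<open>Both sides fix \<open>a\<close> and negate \<open>b\<close> and \<open>c\<close>: the
  product subtracts from \<open>x\<close> twice its component in the plane of \<open>b\<close> and
  \<open>c\<close>.\<close>

lemma line_reflection_polar_frame:
  assumes "polar_frame a b c"
  shows "line_reflection c \<circ> line_reflection b = line_reflection a"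
proof -
  obtain u v w where u: "norm u = 1" "a = span {u}" and v: "norm v = 1" "b = span {v}"
    and w: "norm w = 1" "c = span {w}"
    using assms unfolding polar_frame_def lines_iff by blast
  have orth: "u \<bullet> v = 0" "v \<bullet> w = 0" "u \<bullet> w = 0"
    using assms u(2) v(2) w(2)
    by (auto simp: polar_frame_def orthogonal_lines_def orthogonal_def span_base)
  show ?thesis
  proof
    fix x
    have "(line_reflection c \<circ> line_reflection b) x
      = x - 2 *\<^sub>R ((x \<bullet> v) *\<^sub>R v + (x \<bullet> w) *\<^sub>R w)"
      using u v w orth by (simp add: line_reflection_span inner_diff_left algebra_simps)
    also have "(x \<bullet> v) *\<^sub>R v + (x \<bullet> w) *\<^sub>R w = x - (x \<bullet> u) *\<^sub>R u"
      using orthonormal3_expand[OF u(1) v(1) w(1) orth, of x] by (simp add: algebra_simps)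
    also have "x - 2 *\<^sub>R (x - (x \<bullet> u) *\<^sub>R u) = line_reflection a x"
      using u by (simp add: line_reflection_span algebra_simps scaleR_2)
    finally show "(line_reflection c \<circ> line_reflection b) x = line_reflection a x" .
  qed
qed

text \<open>A line is recovered from its reflection as the set of fixed points.\<close>

lemma line_reflection_inj:
  assumes "a \<in> lines" "b \<in> lines" "line_reflection a = line_reflection b"
  shows "a = b"
proof -
  have fixed: "l = {x. line_reflection l x = x}" if l: "l \<in> lines" for l
  proof -
    obtain u where u: "norm u = 1" "l = span {u}" using l lines_iff by blast
    show ?thesis
    proof (intro Set.set_eqI iffI CollectI)
      fix x assume "x \<in> l"
      then obtain k where "x = k *\<^sub>R u" using u(2) by (auto simp: span_singleton)
      then show "line_reflection l x = x"
        using u by (simp add: line_reflection_span norm_eq_1 flip: scaleR_left_diff_distrib)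
    next
      fix x assume "x \<in> {x. line_reflection l x = x}"
      then have "2 *\<^sub>R x = 2 *\<^sub>R ((x \<bullet> u) *\<^sub>R u)"
        using u by (simp add: line_reflection_span algebra_simps scaleR_2)
      then have "x = (x \<bullet> u) *\<^sub>R u" by (simp only: scaleR_cancel_left) simp
      then show "x \<in> l" using u by (metis insertI1 span_base span_scale)
    qed
  qed
  show ?thesis using fixed[OF assms(1)] fixed[OF assms(2)] assms(3) by simp
qed

text \<open>One pair \<open>a\<close>, \<open>b\<close> serves both the word in the abstract group
  \<open>Q\<close> and the composition of the actual maps, so that information about the maps can
  later be transferred to \<open>Q\<close>.\<close>

lemma word_eq_two_letters:
  fixes Q (structure)
  assumes "group Q"
    and closed: "\<And>l. l \<in> lines \<Longrightarrow> r l \<in> carrier Q"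
    and involution: "\<And>l. l \<in> lines \<Longrightarrow> r l \<otimes> r l = \<one>"
    and pencil: "\<And>a b c d. pencil_relation a b c d \<Longrightarrow> r b \<otimes> r a = r d \<otimes> r c"
    and polar: "\<And>a b c. polar_frame a b c \<Longrightarrow> r c \<otimes> r b = r a"
    and "set ls \<subseteq> lines"
  shows "\<exists>a\<in>lines. \<exists>b\<in>lines. mult_list Q (map r ls) = r a \<otimes> r b \<and>
    foldr (\<circ>) (map line_reflection ls) id = line_reflection a \<circ> line_reflection b"
  using \<open>set ls \<subseteq> lines\<close>
proof (induction ls)
  case Nil
  \<comment> \<open>The empty word is \<open>r l \<otimes> r l\<close> for an arbitrary line; the
    first coordinate axis is taken.\<close>
  obtain l where "l \<in> lines" using span_in_lines[of "axis 1 1"] by (auto simp: norm_axis_1)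
  then show ?case
    using involution line_reflection_involution
    by (intro bexI[of _ l]) (simp_all add: mult_list_def)
next
  case (Cons l ls)
  interpret Q: group Q by fact
  obtain a b where ab: "a \<in> lines" "b \<in> lines" and m: "mult_list Q (map r ls) = r a \<otimes> r b"
    and R: "foldr (\<circ>) (map line_reflection ls) id = line_reflection a \<circ> line_reflection b"
    using Cons.IH Cons.prems unfolding list.set(2) insert_subset by blast
  have "l \<in> lines" using Cons by simp
  then obtain c d m where polar_lmc: "polar_frame l m c" and pencil_badm: "pencil_relation b a d m"
    by (rule exists_pencil_polar_frame[OF _ ab])
  then have lines: "c \<in> lines" "d \<in> lines" "m \<in> lines"
    by (auto simp: polar_frame_def pencil_relation_def)
  have "mult_list Q (map r (l # ls)) = r l \<otimes> (r a \<otimes> r b)"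
    using m by (simp add: mult_list_def)
  also have "\<dots> = (r c \<otimes> r m) \<otimes> (r m \<otimes> r d)"
    using polar[OF polar_lmc] pencil[OF pencil_badm] by simp
  also have "\<dots> = r c \<otimes> (r m \<otimes> r m) \<otimes> r d" using lines closed by (simp add: Q.m_assoc)
  also have "\<dots> = r c \<otimes> r d" using lines closed involution by simp
  finally have 1: "mult_list Q (map r (l # ls)) = r c \<otimes> r d" .
  \<comment> \<open>The same cancellation for the actual maps; here the pencil equation is the last
    conjunct of \<open>pencil_relation_def\<close>.\<close>
  have "foldr (\<circ>) (map line_reflection (l # ls)) id
      = line_reflection l \<circ> (line_reflection a \<circ> line_reflection b)"
    using R by simp
  also have "\<dots> = (line_reflection c \<circ> line_reflection m) \<circ> (line_reflection m \<circ> line_reflection d)"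
    using line_reflection_polar_frame[OF polar_lmc] pencil_badm unfolding pencil_relation_def by metis
  also have "\<dots> = line_reflection c \<circ> (line_reflection m \<circ> line_reflection m) \<circ> line_reflection d"
    by (simp only: comp_assoc)
  also have "\<dots> = line_reflection c \<circ> line_reflection d"
    using line_reflection_involution lines by simp
  finally show ?case using 1 lines by blast
qed

text \<open>The presentation in universal form: elements of any group that obey the three kinds of
  relations obey every relation among the reflections. It will be applied to a quotient of the free
  group.\<close>

lemma relation_in_group:
  fixes Q (structure)
  assumes "group Q"
    and closed: "\<And>l. l \<in> lines \<Longrightarrow> r l \<in> carrier Q"
    and involution: "\<And>l. l \<in> lines \<Longrightarrow> r l \<otimes> r l = \<one>"
    and pencil: "\<And>a b c d. pencil_relation a b c d \<Longrightarrow> r b \<otimes> r a = r d \<otimes> r c"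
    and polar: "\<And>a b c. polar_frame a b c \<Longrightarrow> r c \<otimes> r b = r a"
    and "set ls \<subseteq> lines" "foldr (\<circ>) (map line_reflection ls) id = id"
  shows "mult_list Q (map r ls) = \<one>"
proof -
  obtain a b where ab: "a \<in> lines" "b \<in> lines" "mult_list Q (map r ls) = r a \<otimes> r b"
    "line_reflection a \<circ> line_reflection b = id"
    using word_eq_two_letters[of Q r ls] assms by fastforce
  have "line_reflection a = line_reflection a \<circ> (line_reflection b \<circ> line_reflection b)"
    using ab line_reflection_involution by simp
  also have "\<dots> = line_reflection b" using ab(4) by (simp flip: comp_assoc)
  finally have "a = b" using ab line_reflection_inj by blast
  then show ?thesis using ab involution by simp
qed


section \<open>Generation\<close>

text \<open>The axis is the bisector, spanned by \<open>u + v\<close>. For \<open>v = - u\<close>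
  the bisector degenerates, and \<open>n \<times> u\<close> is taken: it is orthogonal to both
  \<open>u\<close> and \<open>n\<close>, so both are negated.\<close>

lemma exists_line_reflection_swap:
  fixes u v n :: "real^3"
  assumes "norm u = 1" "norm v = 1" "norm n = 1" "n \<bullet> u = 0" "n \<bullet> v = 0"
  obtains l where "l \<in> lines" "line_reflection l u = v" "line_reflection l n = - n"
proof (cases "u + v = 0")
  case True
  then have v: "v = - u" by (simp add: add_eq_0_iff)
  have nu: "norm (n \<times> u) = 1" using assms by (intro norm_cross_orthonormal)
  show thesis
    by (rule that[of "span {n \<times> u}"])
      (simp_all add: nu span_in_lines line_reflection_span v dot_cross_self)
next
  case False
  define k where "k = norm (u + v)"
  define w where "w = (u + v) /\<^sub>R k"
  have k: "k \<noteq> 0" using False by (simp add: k_def)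
  have w: "norm w = 1" using k by (simp add: w_def k_def)
  \<comment> \<open>As \<open>u\<close> and \<open>v\<close> are unit vectors, both sides equal
    \<open>2 + 2 * (u \<bullet> v)\<close>. Hence the projection of \<open>u\<close> to the axis is
    half of \<open>u + v\<close>.\<close>
  have "k\<^sup>2 = 2 * (u \<bullet> (u + v))"
    using assms by (simp add: k_def power2_norm_eq_inner norm_eq_1 inner_commute algebra_simps)
  then have "2 * (u \<bullet> w) = k"
    using k by (simp add: w_def power2_eq_square divide_simps flip: divide_inverse_commute)
  then have "(2 * (u \<bullet> w)) *\<^sub>R w = u + v" using k by (simp add: w_def)
  moreover have "n \<bullet> w = 0" using assms by (simp add: w_def inner_right_distrib)
  ultimately show thesis
    using w by (intro that[of "span {w}"]) (simp_all add: span_in_lines line_reflection_span)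
qed

text \<open>Determinant 1 enters through the cross product, which an orthogonal map preserves up to
  the factor \<open>det\<close>.\<close>

lemma SO3_props:
  assumes "f \<in> carrier SO3"
  shows "linear f" "norm (f x) = norm x" "f x \<bullet> f y = x \<bullet> y" "f x \<times> f y = f (x \<times> y)"
proof -
  have f: "linear f" "orthogonal_transformation f" "det (matrix f) = 1"
    using assms by (auto simp: SO3_def rotation_matrix_def orthogonal_transformation_matrix)
  then show "linear f" "norm (f x) = norm x" "f x \<bullet> f y = x \<bullet> y" "f x \<times> f y = f (x \<times> y)"
    using cross_orthogonal_transformation[OF f(2), of x y]
    by (simp_all add: orthogonal_transformation_norm orthogonal_transformation_def)
qed

lemma SO3_fixing_two_eq_id:
  assumes f: "f \<in> carrier SO3" and "norm u = 1" "norm v = 1" "u \<bullet> v = 0" "f u = u" "f v = v"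
  shows "f = id"
proof
  fix x
  have w: "norm (u \<times> v) = 1" using assms by (intro norm_cross_orthonormal)
  have fw: "f (u \<times> v) = u \<times> v" using SO3_props(4)[OF f, of u v] assms by simp
  have "x = (x \<bullet> u) *\<^sub>R u + (x \<bullet> v) *\<^sub>R v + (x \<bullet> (u \<times> v)) *\<^sub>R (u \<times> v)"
    using assms w by (subst orthonormal3_expand) (simp_all add: dot_cross_self)
  moreover have "f \<dots> = \<dots>"
    using assms fw SO3_props(1)[OF f] by (simp add: linear_add linear_scale)
  ultimately show "f x = id x" by simp
qed

text \<open>The reflection in \<open>a\<close> returns \<open>f u\<close> to \<open>u\<close>. The
  one in \<open>b\<close> returns the image of \<open>v\<close> to \<open>v\<close> but negates
  \<open>u\<close>, and the one in \<open>c\<close>, the line of \<open>v\<close>, undoes this sign.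
  The composite \<open>h\<close> fixes \<open>u\<close> and \<open>v\<close>, so it is the
  identity.\<close>

lemma SO3_eq_three_reflections:
  assumes f: "f \<in> carrier SO3"
  obtains a b c where "a \<in> lines" "b \<in> lines" "c \<in> lines"
    "f = line_reflection a \<circ> (line_reflection b \<circ> line_reflection c)"
proof -
  interpret S: group SO3 by (rule group_SO3)
  have mult: "x \<otimes>\<^bsub>SO3\<^esub> y = x \<circ> y" for x y by (simp add: SO3_def)
  define u v :: "real^3" where "u = axis 1 1" and "v = axis 2 1"
  have uv: "norm u = 1" "norm v = 1" "u \<bullet> v = 0"
    by (simp_all add: u_def v_def norm_axis_1 inner_axis_axis)
  obtain n where n: "norm n = 1" "n \<bullet> u = 0" "n \<bullet> f u = 0" by (rule exists_unit_orthogonal2)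
  obtain a where a: "a \<in> lines" "line_reflection a (f u) = u"
    using exists_line_reflection_swap[of "f u" u n] n uv SO3_props(2)[OF f] by metis
  define g where "g = line_reflection a \<circ> f"
  have g: "g \<in> carrier SO3" "g u = u"
    using S.m_closed[OF line_reflection_in_SO3[OF a(1)] f] a by (simp_all add: g_def mult)
  have ug: "u \<bullet> g v = 0" using SO3_props(3)[OF g(1), of u v] g uv by simp
  \<comment> \<open>Here \<open>u\<close> itself takes the role of the normal
    \<open>n\<close>.\<close>
  obtain b where b: "b \<in> lines" "line_reflection b (g v) = v" "line_reflection b u = - u"
    using exists_line_reflection_swap[of "g v" v u] uv ug SO3_props(2)[OF g(1)] by metis
  define c where "c = span {v}"
  have c: "c \<in> lines" "line_reflection c v = v" "line_reflection c (- u) = u"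
    using uv by (simp_all add: c_def span_in_lines line_reflection_span norm_eq_1 scaleR_2)
  define h where "h = line_reflection c \<circ> (line_reflection b \<circ> g)"
  have "h \<in> carrier SO3"
    using S.m_closed[OF line_reflection_in_SO3[OF c(1)]
        S.m_closed[OF line_reflection_in_SO3[OF b(1)] g(1)]]
    by (simp add: h_def mult)
  moreover have "h u = u" "h v = v" using b c g by (simp_all add: h_def)
  ultimately have "h = id" using SO3_fixing_two_eq_id uv by blast
  have inv: "line_reflection l (line_reflection l x) = x" if "l \<in> lines" for l x
    using line_reflection_involution[OF that] by (simp add: fun_eq_iff)
  have "f x = line_reflection a (line_reflection b (line_reflection c (h x)))" for x
    using a b c inv by (simp add: h_def g_def)
  then have "f = line_reflection a \<circ> (line_reflection b \<circ> line_reflection c)"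
    using \<open>h = id\<close> by (simp add: fun_eq_iff)
  then show thesis using that a b c by blast
qed

lemma generate_line_reflections: "generate SO3 (line_reflection ` lines) = carrier SO3"
proof
  show "generate SO3 (line_reflection ` lines) \<subseteq> carrier SO3"
    using line_reflection_in_SO3 by (intro group.generate_incl[OF group_SO3]) auto
  show "carrier SO3 \<subseteq> generate SO3 (line_reflection ` lines)"
  proof
    fix f assume "f \<in> carrier SO3"
    then obtain a b c where abc: "a \<in> lines" "b \<in> lines" "c \<in> lines"
      and f: "f = line_reflection a \<circ> (line_reflection b \<circ> line_reflection c)"
      by (rule SO3_eq_three_reflections)
    have "f = line_reflection a \<otimes>\<^bsub>SO3\<^esub> (line_reflection b \<otimes>\<^bsub>SO3\<^esub> line_reflection c)"
      by (simp add: f SO3_def)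
    also have "\<dots> \<in> generate SO3 (line_reflection ` lines)"
      using abc by (intro generate.eng) (auto intro: generate.incl)
    finally show "f \<in> generate SO3 (line_reflection ` lines)" .
  qed
qed


section \<open>The presentation\<close>

lemma hom_mult_list:
  assumes "group G" "group H" "h \<in> hom G H" "set xs \<subseteq> carrier G"
  shows "h (mult_list G xs) = mult_list H (map h xs)" "mult_list G xs \<in> carrier G"
proof -
  interpret G: group G by fact
  interpret H: group H by fact
  \<comment> \<open>The two claims share one induction, since \<open>hom_mult\<close> needs the
    product of the tail to lie in the carrier.\<close>
  have "h (mult_list G xs) = mult_list H (map h xs) \<and> mult_list G xs \<in> carrier G"
    using assms(4)
    by (induction xs)
      (use assms(3) in \<open>auto simp: mult_list_def hom_mult hom_one[OF assms(3,1,2)]\<close>)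
  then show "h (mult_list G xs) = mult_list H (map h xs)" "mult_list G xs \<in> carrier G" by auto
qed

text \<open>In the quotient by the normal closure \<open>N\<close> all relators become trivial, so
  \<open>relation_in_group\<close> applies to the cosets of the generators. A word with trivial
  coset lies in \<open>N\<close>.\<close>

lemma relation_in_normal_closure:
  assumes "set ls \<subseteq> lines" "foldr (\<circ>) (map line_reflection ls) id = id"
  shows "mult_list line_group (map free_gen ls) \<in> normal_closure line_group
    (involution_relators \<union> pencil_relators \<union> polar_frame_relators)"
    (is "?x \<in> normal_closure _ ?T")
proof -
  interpret G: group line_group by (rule group_free_group)
  define N where "N = normal_closure line_group ?T"
  note gen = free_gen_closed[of _ lines]
  have T: "?T \<subseteq> carrier line_group"
    by (auto simp: involution_relators_def pencil_relators_def polar_frame_relators_def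
        pencil_relation_def polar_frame_def gen)
  interpret N: normal N line_group
    unfolding N_def by (rule G.normal_closure_normal[OF T])
  let ?Q = "line_group Mod N"
  interpret Q: group ?Q by (rule N.factorgroup_is_group)
  define p where "p x = N #>\<^bsub>line_group\<^esub> x" for x
  define r where "r l = p (free_gen l)" for l
  have hom: "p \<in> hom line_group ?Q"
    using N.r_coset_hom_Mod by (simp add: p_def[abs_def])
  interpret p: group_hom line_group ?Q p by unfold_locales (rule hom)
  have T_N: "?T \<subseteq> N" unfolding N_def normal_closure_def by blast
  have one: "p x = \<one>\<^bsub>?Q\<^esub>" if "x \<in> ?T" for x
    using that T T_N G.coset_join2[of x N] N.subgroup_axioms by (auto simp: p_def)
  have closed: "r l \<in> carrier ?Q" if "l \<in> lines" for l
    using that gen by (simp add: r_def)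
  have involution: "r l \<otimes>\<^bsub>?Q\<^esub> r l = \<one>\<^bsub>?Q\<^esub>" if "l \<in> lines" for l
  proof -
    have "p (free_gen l \<otimes>\<^bsub>line_group\<^esub> free_gen l) = \<one>\<^bsub>?Q\<^esub>"
      using that by (intro one) (auto simp: involution_relators_def)
    then show ?thesis using that gen by (simp only: r_def p.hom_mult)
  qed
  have pencil: "r b \<otimes>\<^bsub>?Q\<^esub> r a = r d \<otimes>\<^bsub>?Q\<^esub> r c" if "pencil_relation a b c d" for a b c d
  proof -
    have lines: "a \<in> lines" "b \<in> lines" "c \<in> lines" "d \<in> lines"
      using that by (auto simp: pencil_relation_def)
    have "p ((free_gen b \<otimes>\<^bsub>line_group\<^esub> free_gen a) \<otimes>\<^bsub>line_group\<^esub>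
       inv\<^bsub>line_group\<^esub> (free_gen d \<otimes>\<^bsub>line_group\<^esub> free_gen c)) = \<one>\<^bsub>?Q\<^esub>"
      using that by (intro one) (auto simp: pencil_relators_def)
    then have "(r b \<otimes>\<^bsub>?Q\<^esub> r a) \<otimes>\<^bsub>?Q\<^esub> inv\<^bsub>?Q\<^esub> (r d \<otimes>\<^bsub>?Q\<^esub> r c) = \<one>\<^bsub>?Q\<^esub>"
      using lines gen by (simp only: r_def p.hom_mult p.hom_inv G.m_closed G.inv_closed)
    then show ?thesis
      using lines closed Q.inv_equality Q.inv_inv Q.inv_closed Q.m_closed by metis
  qed
  have polar: "r c \<otimes>\<^bsub>?Q\<^esub> r b = r a" if "polar_frame a b c" for a b c
  proof -
    have lines: "a \<in> lines" "b \<in> lines" "c \<in> lines"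
      using that by (auto simp: polar_frame_def)
    have "p (free_gen c \<otimes>\<^bsub>line_group\<^esub> free_gen b \<otimes>\<^bsub>line_group\<^esub> free_gen a) = \<one>\<^bsub>?Q\<^esub>"
      using that by (intro one) (auto simp: polar_frame_relators_def)
    then have "r c \<otimes>\<^bsub>?Q\<^esub> r b \<otimes>\<^bsub>?Q\<^esub> r a = \<one>\<^bsub>?Q\<^esub>"
      using lines gen by (simp only: r_def p.hom_mult G.m_closed)
    \<comment> \<open>By the involution relation 1 is also \<open>r a\<close> times itself, so
      \<open>r a\<close> cancels on the right.\<close>
    then show ?thesis
      using lines closed involution Q.m_closed Q.right_cancel by metis
  qed
  have gens: "set (map free_gen ls) \<subseteq> carrier line_group" using assms gen by auto
  have "p ?x = mult_list ?Q (map r ls)"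
    using hom_mult_list(1)[OF G.is_group Q.is_group hom gens] by (simp add: r_def[abs_def] comp_def)
  also have "\<dots> = \<one>\<^bsub>?Q\<^esub>"
    by (rule relation_in_group[OF Q.is_group closed involution pencil polar assms])
  finally have "N #>\<^bsub>line_group\<^esub> ?x = N" by (simp add: p_def)
  then have "?x \<in> N"
    using G.coset_join1 hom_mult_list(2)[OF G.is_group Q.is_group hom gens] N.subgroup_axioms
    by blast
  then show ?thesis by (simp add: N_def)
qed

theorem theorem6:
  shows "generate SO3 (line_reflection ` lines) = carrier SO3
    \<and> (\<forall>ls. set ls \<subseteq> lines \<longrightarrow> foldr (\<circ>) (map line_reflection ls) id = id \<longrightarrow>
          mult_list (free_group lines) (map free_gen ls)
            \<in> normal_closure (free_group lines)
                (involution_relators \<union> pencil_relators \<union> polar_frame_relators))"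
  using generate_line_reflections relation_in_normal_closure by blast

end
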